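(* Let $n\geq 2$ and let $\Omega\subset\mathbb{C}^n$ be a bounded convex domain with $\mathcal{C}^1$-smooth boundary. Assume that there exist $C>0$ and $\alpha\in(0,1)$ such that $\Omega$ is supported from the outside by the function $F(z') := C\,\Psi_{\alpha}(\|z'\|)$ (writing $z=(z',z_n)$ for each $z\in\mathbb{C}^n$, with $z'\in\mathbb{C}^{n-1}$). Then every complex geodesic $f:\mathbb{D}\to\Omega$ of $\Omega$ extends continuously up to $\partial\mathbb{D}$ (that is, $f$ extends to a continuous map on $\overline{\mathbb{D}}$).
   Context: $\mathbb{D}$ is the open unit disc in $\mathbb{C}$ centered at $0$; $\|\cdot\|$ is the Euclidean norm; $B^{d}(a;r)$ is the Euclidean ball in $\mathbb{C}^d$ with centre $a$ and radius $r$. Complex geodesic: for a bounded domain $\Omega\subset\mathbb{C}^n$, a holomorphic map $f:\mathbb{D}\to\Omega$ is a complex geodesic of $\Omega$ if it is an isometry for the Kobayashi distances on $\mathbb{D}$ and $\Omega$. The function $\Psi_\alpha$: for $\alpha>0$, $\Psi_\alpha:[0,\infty)\to\mathbb{R}$ is defined by $\Psi_\alpha(x)=e^{-1/x^{\alpha}}$ if $x>0$ and $\Psi_\alpha(0)=0$. Complex tangent space: for $w\in\partial\Omega$ (with $\partial\Omega$ of class $\mathcal{C}^1$), $H_w(\partial\Omega):=T_w(\partial\Omega)\cap iT_w(\partial\Omega)$. Support from the outside: let $\Omega$ be a bounded convex domain in $\mathbb{C}^n$, $n\geq 2$, with $\mathcal{C}^1$-smooth boundary, and let $F:B^{n-1}(0;r)\to\mathbb{R}$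 be a smooth function with $F(0)=0$ and $DF(0)=0$. We say that $F$ supports $\Omega$ from the outside if there exist constants $R_0\in(0,r)$ and $s_0>0$ such that, for each $w\in\partial\Omega$, there exists a unitary transformation $\mathsf{U}_w$ of $\mathbb{C}^n$ satisfying - $\mathsf{U}_w(H_w(\partial\Omega))=\{v\in\mathbb{C}^n: v_n=0\}$, and - $\mathsf{U}_w(\nu_w)=(0,\dots,0,i)$, where $\nu_w$ is the inward unit normal vector to $\partial\Omega$ at $w$, such that, denoting by $\mathsf{U}^w$ the $\mathbb{C}$-affine map $v\mapsto\mathsf{U}_w(v-w)$ and writing $Q:=B^{n-1}(0;R_0)\times\big((-s_0,s_0)+i(-s_0,s_0)\big)$, we have $$\mathsf{U}^w(\overline{\Omega})\cap Q\ \subset\ \{z=(z',z_n)\in Q:\ \mathrm{Im}(z_n)\geq F(z')\}.$$ *)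

theory Defs
  imports "HOL-Complex_Analysis.Complex_Analysis"
begin

unbundle no fps_syntax

(* C^n is complex ^ 'n with its Euclidean norm, real inner product (the real part of the
   Hermitian one) and complex scalar multiplication *s.  Where the splitting z = (z', z_n)
   is needed the index type is 'm option: None is the last coordinate, the coordinates Some i
   make up z' :: complex ^ 'm, and n = CARD('m) + 1. *)

lemma CARD_option_ge_2: "CARD(('m::finite) option) \<ge> 2"
  using zero_less_card_finite[where 'a = 'm] by (simp add: card_UNIV_option)

definition init_coords :: "complex ^ ('m::finite) option \<Rightarrow> complex ^ 'm" where
  "init_coords z = (\<chi> i. z $ Some i)"

definition last_coord :: "complex ^ ('m::finite) option \<Rightarrow> complex" where
  "last_coord z = z $ None"

definition vec_holomorphic_on :: "(complex \<Rightarrow> complex ^ 'n) \<Rightarrow> complex set \<Rightarrow> bool"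
    (infixl "vec'_holomorphic'_on" 50) where
  "f vec_holomorphic_on S \<longleftrightarrow> (\<forall>i. (\<lambda>\<zeta>. f \<zeta> $ i) holomorphic_on S)"


section \<open>Kobayashi distance and complex geodesics\<close>

definition poincare_dist :: "complex \<Rightarrow> complex \<Rightarrow> real" where
  "poincare_dist a b = artanh (cmod (a - b) / cmod (1 - cnj a * b))"

(* H is the set of all holomorphic maps from the unit disc into the given domain; keeping it as
   a parameter lets one definition serve domains in complex and in complex ^ 'n. *)
definition kobayashi_dist :: "(complex \<Rightarrow> 'a) set \<Rightarrow> 'a \<Rightarrow> 'a \<Rightarrow> real" where
  "kobayashi_dist H p q = Inf {\<Sum>j<k. poincare_dist (a j) (b j) | (k :: nat) x \<phi> a b.
     x 0 = p \<and> x k = q \<and>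
     (\<forall>j<k. \<phi> j \<in> H \<and> a j \<in> ball 0 1 \<and> b j \<in> ball 0 1 \<and>
            \<phi> j (a j) = x j \<and> \<phi> j (b j) = x (Suc j))}"

definition kobayashi_disc :: "complex \<Rightarrow> complex \<Rightarrow> real" where
  "kobayashi_disc =
     kobayashi_dist {\<phi>. \<phi> holomorphic_on ball 0 1 \<and> \<phi> ` ball 0 1 \<subseteq> ball 0 1}"

definition kobayashi_vec :: "(complex ^ 'n) set \<Rightarrow> complex ^ 'n \<Rightarrow> complex ^ 'n \<Rightarrow> real" where
  "kobayashi_vec \<Omega> =
     kobayashi_dist {\<phi>. \<phi> vec_holomorphic_on ball 0 1 \<and> \<phi> ` ball 0 1 \<subseteq> \<Omega>}"

definition complex_geodesic :: "(complex ^ 'n) set \<Rightarrow> (complex \<Rightarrow> complex ^ 'n) \<Rightarrow> bool" where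
  "complex_geodesic \<Omega> f \<longleftrightarrow>
     f vec_holomorphic_on ball 0 1 \<and> f ` ball 0 1 \<subseteq> \<Omega> \<and>
     (\<forall>\<zeta>\<in>ball 0 1. \<forall>\<xi>\<in>ball 0 1. kobayashi_vec \<Omega> (f \<zeta>) (f \<xi>) = kobayashi_disc \<zeta> \<xi>)"


section \<open>Smoothness, boundaries of class C1, tangent spaces and normals\<close>

(* Intended for open S in a finite-dimensional space. *)
primrec Ck_on :: "nat \<Rightarrow> 'a::real_normed_vector set \<Rightarrow> ('a \<Rightarrow> real) \<Rightarrow> bool" where
  "Ck_on 0 S f \<longleftrightarrow> continuous_on S f"
| "Ck_on (Suc k) S f \<longleftrightarrow>
     (\<exists>f'. (\<forall>x\<in>S. (f has_derivative f' x) (at x)) \<and> (\<forall>v. Ck_on k S (\<lambda>x. f' x v)))"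

definition smooth_on :: "'a::real_normed_vector set \<Rightarrow> ('a \<Rightarrow> real) \<Rightarrow> bool" where
  "smooth_on S f \<longleftrightarrow> (\<forall>k. Ck_on k S f)"

(* G is the gradient of \<rho>.  Since it does not vanish, the boundary of \<Omega> inside V is
   the zero set of \<rho>. *)
definition local_defining_function ::
    "'a::real_inner set \<Rightarrow> 'a \<Rightarrow> 'a set \<Rightarrow> ('a \<Rightarrow> real) \<Rightarrow> ('a \<Rightarrow> 'a) \<Rightarrow> bool" where
  "local_defining_function \<Omega> w V \<rho> G \<longleftrightarrow>
     open V \<and> w \<in> V \<and> (\<forall>x\<in>V. GDERIV \<rho> x :> G x) \<and> continuous_on V G \<and> (\<forall>x\<in>V. G x \<noteq> 0) \<and>
     \<Omega> \<inter> V = {x \<in> V. \<rho> x < 0}"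

definition C1_boundary :: "'a::real_inner set \<Rightarrow> bool" where
  "C1_boundary \<Omega> \<longleftrightarrow> (\<forall>w\<in>frontier \<Omega>. \<exists>V \<rho> G. local_defining_function \<Omega> w V \<rho> G)"

definition tangent_space :: "'a::real_inner set \<Rightarrow> 'a \<Rightarrow> 'a set" where
  "tangent_space \<Omega> w = {v. \<exists>V \<rho> G. local_defining_function \<Omega> w V \<rho> G \<and> v \<bullet> G w = 0}"

definition inward_unit_normal :: "'a::real_inner set \<Rightarrow> 'a \<Rightarrow> 'a" where
  "inward_unit_normal \<Omega> w =
     (THE \<nu>. \<exists>V \<rho> G. local_defining_function \<Omega> w V \<rho> G \<and> \<nu> = - sgn (G w))"

(* The tangent space and the normal do not depend on the choice of defining function. *)

lemma local_defining_function_zero: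
  assumes "local_defining_function \<Omega> w V \<rho> G" "w \<in> frontier \<Omega>"
  shows "\<rho> w = 0"
proof -
  have V: "open V" "w \<in> V" and \<Omega>: "\<Omega> \<inter> V = {x \<in> V. \<rho> x < 0}"
    and "\<forall>x\<in>V. GDERIV \<rho> x :> G x"
    using assms by (auto simp: local_defining_function_def)
  then have cont: "continuous_on V \<rho>"
    by (auto simp: gderiv_def intro!: continuous_at_imp_continuous_on has_derivative_continuous)
  have "open (V \<inter> \<rho> -` {..<0})" "open (V \<inter> \<rho> -` {0<..})"
    using cont V by (auto intro: continuous_open_preimage)
  moreover have "V \<inter> \<rho> -` {..<0} \<subseteq> \<Omega>" "V \<inter> \<rho> -` {0<..} \<inter> \<Omega> = {}"
    using \<Omega> by force+
  moreover have "w \<notin> interior \<Omega>" "w \<in> closure \<Omega>"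
    using assms(2) by (auto simp: frontier_def)
  ultimately have "w \<notin> V \<inter> \<rho> -` {..<0}" "w \<notin> V \<inter> \<rho> -` {0<..}"
    using interiorI[of "V \<inter> \<rho> -` {..<0}" w \<Omega>]
      open_Int_closure_eq_empty[of "V \<inter> \<rho> -` {0<..}" \<Omega>] by blast+
  then show ?thesis
    using V by auto
qed

lemma gderiv_along_ray:
  assumes "GDERIV \<rho> w :> g"
  shows "((\<lambda>t. \<rho> (w + t *\<^sub>R v)) has_real_derivative v \<bullet> g) (at 0)"
proof -
  have "((\<lambda>t. w + t *\<^sub>R v) has_derivative (\<lambda>t. t *\<^sub>R v)) (at (0::real))"
    by (auto intro!: derivative_eq_intros)
  moreover have "(\<rho> has_derivative (\<lambda>h. h \<bullet> g)) (at (w + 0 *\<^sub>R v))"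
    using assms by (simp add: gderiv_def)
  ultimately show ?thesis
    using has_derivative_compose[of "\<lambda>t. w + t *\<^sub>R v" "\<lambda>t. t *\<^sub>R v" 0 UNIV \<rho> "\<lambda>h. h \<bullet> g"]
    by (simp add: has_field_derivative_def mult_commute_abs)
qed

lemma local_defining_function_sgn_unique:
  assumes 1: "local_defining_function \<Omega> w V1 \<rho>1 G1"
    and 2: "local_defining_function \<Omega> w V2 \<rho>2 G2" and w: "w \<in> frontier \<Omega>"
  shows "sgn (G1 w) = sgn (G2 w)"
proof -
  have z: "\<rho>1 w = 0" "\<rho>2 w = 0"
    using 1 2 w local_defining_function_zero by blast+
  have g: "G1 w \<noteq> 0" "G2 w \<noteq> 0" "GDERIV \<rho>1 w :> G1 w" "GDERIV \<rho>2 w :> G2 w"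
    and V: "open V1" "w \<in> V1" "open V2" "w \<in> V2"
    and \<Omega>: "\<Omega> \<inter> V1 = {x \<in> V1. \<rho>1 x < 0}" "\<Omega> \<inter> V2 = {x \<in> V2. \<rho>2 x < 0}"
    using 1 2 by (auto simp: local_defining_function_def)
  have key: "v \<bullet> G2 w \<le> 0" if v: "v \<bullet> G1 w < 0" for v
  proof (rule ccontr)
    assume "\<not> v \<bullet> G2 w \<le> 0"
    then obtain d2 where d2: "d2 > 0" "\<And>t. 0 < t \<Longrightarrow> t < d2 \<Longrightarrow> 0 < \<rho>2 (w + t *\<^sub>R v)"
      using has_real_derivative_pos_inc_right[OF gderiv_along_ray[OF g(4)], of v] z by force
    obtain d1 where d1: "d1 > 0" "\<And>t. 0 < t \<Longrightarrow> t < d1 \<Longrightarrow> \<rho>1 (w + t *\<^sub>R v) < 0"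
      using has_real_derivative_neg_dec_right[OF gderiv_along_ray[OF g(3)] v] z by force
    have "((\<lambda>t. w + t *\<^sub>R v) \<longlongrightarrow> w + 0 *\<^sub>R v) (at_right (0::real))"
      by (intro tendsto_intros)
    then have "\<forall>\<^sub>F t in at_right (0::real). w + t *\<^sub>R v \<in> V1 \<inter> V2"
      using V by (intro topological_tendstoD) auto
    moreover have "\<forall>\<^sub>F t in at_right (0::real). 0 < t \<and> t < d1 \<and> t < d2"
      using d1(1) d2(1) by (auto simp: eventually_at_right_field intro!: exI[of _ "min d1 d2"])
    ultimately have "\<forall>\<^sub>F t in at_right (0::real). False"
    proof eventually_elim
      case (elim t)
      then have "w + t *\<^sub>R v \<in> \<Omega> \<inter> V1"
        using d1(2)[of t] \<Omega> by auto
      then have "w + t *\<^sub>R v \<in> \<Omega> \<inter> V2"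
        using elim by auto
      then show ?case
        using d2(2)[of t] elim \<Omega> by auto
    qed
    then show False by simp
  qed
  let ?a = "sgn (G1 w)" and ?b = "sgn (G2 w)"
  have ab: "?a \<bullet> ?a = 1" "?b \<bullet> ?b = 1"
    using g by (simp_all add: norm_sgn dot_square_norm)
  have G1: "v \<bullet> G1 w = norm (G1 w) * (v \<bullet> ?a)" and G2: "v \<bullet> G2 w = norm (G2 w) * (v \<bullet> ?b)" for v
    using g by (simp_all add: sgn_div_norm)
  have "?a \<bullet> ?b \<ge> 1"
  proof (rule ccontr)
    assume n: "\<not> ?a \<bullet> ?b \<ge> 1"
    have "(?b - ?a) \<bullet> G1 w = norm (G1 w) * (?a \<bullet> ?b - 1)"
      unfolding G1 inner_diff_left using ab by (simp only: inner_commute[of ?b ?a])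
    then have "(?b - ?a) \<bullet> G1 w < 0"
      using n g by (simp add: mult_less_0_iff)
    moreover have "(?b - ?a) \<bullet> G2 w = norm (G2 w) * (1 - ?a \<bullet> ?b)"
      unfolding G2 inner_diff_left using ab by simp
    ultimately show False
      using key[of "?b - ?a"] n g by (simp add: mult_le_0_iff)
  qed
  then have "(?a - ?b) \<bullet> (?a - ?b) \<le> 0"
    using ab by (simp add: inner_diff_left inner_diff_right inner_commute)
  then show ?thesis
    by (metis inner_gt_zero_iff not_le right_minus_eq)
qed

lemma inward_unit_normal_eq:
  assumes "local_defining_function \<Omega> w V \<rho> G" "w \<in> frontier \<Omega>"
  shows "inward_unit_normal \<Omega> w = - sgn (G w)"
  unfolding inward_unit_normal_def
proof (rule the_equality)
  fix \<nu> assume "\<exists>V \<rho> G. local_defining_function \<Omega> w V \<rho> G \<and> \<nu> = - sgn (G w)"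
  then show "\<nu> = - sgn (G w)"
    by (elim exE conjE) (simp only: local_defining_function_sgn_unique[OF _ assms])
qed (use assms in blast)

lemma tangent_space_eq:
  assumes "local_defining_function \<Omega> w V \<rho> G" "w \<in> frontier \<Omega>"
  shows "tangent_space \<Omega> w = {v. v \<bullet> G w = 0}"
proof -
  have "v \<bullet> G' w = 0 \<longleftrightarrow> v \<bullet> G w = 0" if "local_defining_function \<Omega> w V' \<rho>' G'" for V' \<rho>' G' v
  proof -
    have "v \<bullet> sgn (G' w) = v \<bullet> sgn (G w)"
      using local_defining_function_sgn_unique[OF that assms] by simp
    then show ?thesis
      using that assms by (auto simp: sgn_div_norm local_defining_function_def)
  qed
  then show ?thesis
    unfolding tangent_space_def using assms by blast
qed

definition complex_tangent_space :: "(complex ^ 'n) set \<Rightarrow> complex ^ 'n \<Rightarrow> (complex ^ 'n) set" where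
  "complex_tangent_space \<Omega> w = tangent_space \<Omega> w \<inter> (\<lambda>v. \<i> *s v) ` tangent_space \<Omega> w"


section \<open>Support from the outside\<close>

definition hermitian_inner :: "complex ^ 'n \<Rightarrow> complex ^ 'n \<Rightarrow> complex" where
  "hermitian_inner x y = (\<Sum>i\<in>UNIV. x $ i * cnj (y $ i))"

definition unitary_transformation :: "(complex ^ 'n \<Rightarrow> complex ^ 'n) \<Rightarrow> bool" where
  "unitary_transformation U \<longleftrightarrow>
     Vector_Spaces.linear (*s) (*s) U \<and>
     (\<forall>x y. hermitian_inner (U x) (U y) = hermitian_inner x y)"

definition support_nbhd :: "real \<Rightarrow> real \<Rightarrow> (complex ^ ('m::finite) option) set" where
  "support_nbhd R\<^sub>0 s\<^sub>0 = {z. init_coords z \<in> ball 0 R\<^sub>0 \<and>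
     Re (last_coord z) \<in> {-s\<^sub>0<..<s\<^sub>0} \<and> Im (last_coord z) \<in> {-s\<^sub>0<..<s\<^sub>0}}"

(* Only the values of F on the ball of radius r matter. *)
definition supports_from_outside ::
    "real \<Rightarrow> (complex ^ 'm \<Rightarrow> real) \<Rightarrow> (complex ^ ('m::finite) option) set \<Rightarrow> bool" where
  "supports_from_outside r F \<Omega> \<longleftrightarrow>
     smooth_on (ball 0 r) F \<and> F 0 = 0 \<and> (F has_derivative (\<lambda>_. 0)) (at 0) \<and>
     (\<exists>R\<^sub>0 s\<^sub>0. 0 < R\<^sub>0 \<and> R\<^sub>0 < r \<and> 0 < s\<^sub>0 \<and>
       (\<forall>w\<in>frontier \<Omega>. \<exists>U. unitary_transformation U \<and>
          U ` complex_tangent_space \<Omega> w = {v. last_coord v = 0} \<and>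
          U (inward_unit_normal \<Omega> w) = axis None \<i> \<and>
          (\<lambda>v. U (v - w)) ` closure \<Omega> \<inter> support_nbhd R\<^sub>0 s\<^sub>0
            \<subseteq> {z \<in> support_nbhd R\<^sub>0 s\<^sub>0. Im (last_coord z) \<ge> F (init_coords z)}))"

definition Psi :: "real \<Rightarrow> real \<Rightarrow> real" where
  "Psi \<alpha> x = (if x > 0 then exp (- 1 / x powr \<alpha>) else 0)"

end

(* Let delta(z) be the distance of z to the complement of the domain.  Chains of affine discs along
   a segment bound the Kobayashi distance by a multiple of log (1 / delta), so a geodesic satisfies
   delta(f(zeta)) <= B q^k on the circle |zeta| = 1 - 4^(-k), for some q < 1.  Let w be a boundary
   point nearest to f(zeta).  By convexity, scaling towards w turns the local support condition at w
   into a global half-space condition.  So the complex normal coordinate of f at w has values in a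
   half-plane, and by the Schwarz lemma it stays of size O(delta) on the disc around zeta of radius
   3/4 (1 - |zeta|); the supporting function then bounds the tangential coordinates there by
   O((log (1 / delta))^(-1/alpha)) = O(k^(-1/alpha)).  These bounds are summable because alpha < 1,
   and by the maximum principle the dilates f((1 - 4^(-k)) u) converge uniformly on the closed
   disc. *)
theory Submission
  imports Defs
begin

section \<open>Poincare distance, Schwarz-Pick, and a lower bound for the Kobayashi distance of the
  disc\<close>

lemma artanh_mono_real:
  fixes x y :: real
  assumes "-1 < x" "x \<le> y" "y < 1"
  shows "artanh x \<le> artanh y"
  unfolding artanh_def using assms
  by (intro divide_right_mono ln_mono frac_le) auto

lemma artanh_diff_real:
  fixes x y :: real
  assumes "\<bar>x\<bar> < 1" "\<bar>y\<bar> < 1"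
  shows "artanh x - artanh y = artanh ((x - y) / (1 - x * y))"
proof -
  have xy: "\<bar>x * y\<bar> < 1"
    using assms by (simp add: abs_mult) (metis abs_ge_zero mult_strict_mono' mult_1)
  have "(1 + (x - y) / (1 - x * y)) / (1 - (x - y) / (1 - x * y))
      = ((1 + x) * (1 - y)) / ((1 - x) * (1 + y))"
  proof -
    have "1 + (x - y) / (1 - x * y) = ((1 + x) * (1 - y)) / (1 - x * y)"
      "1 - (x - y) / (1 - x * y) = ((1 - x) * (1 + y)) / (1 - x * y)"
      using xy by (simp_all add: field_simps)
    then show ?thesis using xy by simp
  qed
  moreover have "1 + x \<noteq> 0" "1 - x \<noteq> 0" "1 + y \<noteq> 0" "1 - y \<noteq> 0"
    using assms by auto
  ultimately show ?thesis
    by (simp add: artanh_def ln_div ln_mult flip: diff_divide_distrib)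
qed

text \<open>This identity yields both that the pseudohyperbolic distance is less than 1 and a
  formula for one minus its square.\<close>

lemma cmod_one_minus_cnj_mult:
  "(cmod (1 - cnj a * b))\<^sup>2 - (cmod (a - b))\<^sup>2 = (1 - (cmod a)\<^sup>2) * (1 - (cmod b)\<^sup>2)"
  unfolding cmod_power2 by (simp add: power2_eq_square algebra_simps)

lemma one_minus_cnj_mult_pos:
  assumes "cmod a < 1" "cmod b < 1"
  shows "0 < cmod (1 - cnj a * b)"
proof -
  have "cmod (cnj a * b) < 1"
    using assms by (simp add: norm_mult) (metis mult_strict_mono' norm_ge_zero mult_1)
  then show ?thesis by auto
qed

lemma pseudohyperbolic_less_1:
  assumes "cmod a < 1" "cmod b < 1"
  shows "cmod (a - b) / cmod (1 - cnj a * b) < 1"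
proof -
  have "0 < (1 - (cmod a)\<^sup>2) * (1 - (cmod b)\<^sup>2)"
    using assms by (simp add: power_less_one_iff)
  then have "(cmod (a - b))\<^sup>2 < (cmod (1 - cnj a * b))\<^sup>2"
    using cmod_one_minus_cnj_mult[of a b] by simp
  then show ?thesis
    using one_minus_cnj_mult_pos[OF assms] power2_less_imp_less[of "cmod (a - b)"] by simp
qed

lemma poincare_dist_nonneg:
  assumes "cmod a < 1" "cmod b < 1"
  shows "0 \<le> poincare_dist a b"
  using artanh_mono_real[OF _ _ pseudohyperbolic_less_1[OF assms], of 0]
  by (simp add: poincare_dist_def)

text \<open>The triangle inequality with base point 0, where \<open>artanh (cmod z)\<close> is the
  distance from 0 to \<open>z\<close>. For fixed moduli of \<open>a\<close> and \<open>b\<close>,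
  one minus the squared pseudohyperbolic distance has a fixed numerator, and its denominator is
  smallest when \<open>a\<close> and \<open>b\<close> lie on one ray.\<close>

lemma artanh_cmod_diff_le_poincare_dist:
  assumes a: "cmod a < 1" and b: "cmod b < 1"
  shows "artanh (cmod b) - artanh (cmod a) \<le> poincare_dist a b"
proof -
  let ?x = "cmod a" and ?y = "cmod b" and ?d = "cmod (1 - cnj a * b)"
  have xy: "?y * ?x < 1"
    using assms by (metis mult_strict_mono' norm_ge_zero mult_1)
  have d: "0 < ?d" using one_minus_cnj_mult_pos[OF assms] .
  have "1 - ?y * ?x \<le> ?d"
    using norm_triangle_ineq2[of 1 "cnj a * b"] by (simp add: norm_mult mult.commute)
  then have sq: "(1 - ?y * ?x)\<^sup>2 \<le> ?d\<^sup>2"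
    using xy by (intro power_mono) auto
  have "0 \<le> (1 - ?x\<^sup>2) * (1 - ?y\<^sup>2)"
    using assms by (simp add: power_le_one)
  then have "(1 - ?x\<^sup>2) * (1 - ?y\<^sup>2) / ?d\<^sup>2 \<le> (1 - ?x\<^sup>2) * (1 - ?y\<^sup>2) / (1 - ?y * ?x)\<^sup>2"
    using sq xy by (intro divide_left_mono mult_pos_pos) (auto simp: d)
  moreover have "1 - (cmod (a - b) / ?d)\<^sup>2 = (1 - ?x\<^sup>2) * (1 - ?y\<^sup>2) / ?d\<^sup>2"
    using d cmod_one_minus_cnj_mult[of a b] by (simp add: field_simps)
  moreover have "1 - ((?y - ?x) / (1 - ?y * ?x))\<^sup>2 = (1 - ?x\<^sup>2) * (1 - ?y\<^sup>2) / (1 - ?y * ?x)\<^sup>2"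
    using xy by (simp add: field_simps) (simp add: power2_eq_square algebra_simps)
  ultimately have "((?y - ?x) / (1 - ?y * ?x))\<^sup>2 \<le> (cmod (a - b) / ?d)\<^sup>2"
    by simp
  then have "\<bar>(?y - ?x) / (1 - ?y * ?x)\<bar> \<le> cmod (a - b) / ?d"
    using d by (metis abs_le_square_iff abs_of_nonneg divide_nonneg_nonneg norm_ge_zero)
  then have "artanh ((?y - ?x) / (1 - ?y * ?x)) \<le> poincare_dist a b"
    unfolding poincare_dist_def using pseudohyperbolic_less_1[OF assms]
    by (intro artanh_mono_real) linarith+
  then show ?thesis
    using assms by (simp add: artanh_diff_real)
qed

text \<open>Conjugating with the Moebius maps that take 0 to \<open>a\<close> and
  \<open>\<phi> a\<close> to 0 gives a self-map of the disc fixing 0, to which the Schwarz lemma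
  applies.\<close>

lemma Schwarz_Pick:
  assumes hol: "\<phi> holomorphic_on ball 0 1" and img: "\<phi> ` ball 0 1 \<subseteq> ball 0 1"
    and a: "cmod a < 1" and b: "cmod b < 1"
  shows "poincare_dist (\<phi> a) (\<phi> b) \<le> poincare_dist a b"
proof -
  let ?M = "Moebius_function 0"
  have \<phi>: "cmod (\<phi> z) < 1" if "cmod z < 1" for z
    using img that by (auto simp: image_subset_iff)
  define h where "h = ?M (\<phi> a) \<circ> \<phi> \<circ> ?M (- a)"
  have na: "cmod (- a) < 1" using a by simp
  have M1: "?M (- a) ` ball 0 1 \<subseteq> ball 0 1"
    using Moebius_function_norm_lt_1[OF na] by auto
  have "\<phi> \<circ> ?M (- a) holomorphic_on ball 0 1"
    by (rule holomorphic_on_compose_gen[OF Moebius_function_holomorphic[OF na] hol M1])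
  moreover have "(\<phi> \<circ> ?M (- a)) ` ball 0 1 \<subseteq> ball 0 1"
    using M1 img by fastforce
  ultimately have holh: "h holomorphic_on ball 0 1"
    unfolding h_def comp_assoc
    by (intro holomorphic_on_compose_gen[OF _ Moebius_function_holomorphic[OF \<phi>[OF a]]])
  have h1: "cmod (h z) < 1" if "cmod z < 1" for z
    unfolding h_def o_def using that na a by (intro Moebius_function_norm_lt_1 \<phi>) auto
  have h0: "h 0 = 0"
    by (simp add: h_def Moebius_function_simple)
  have "cmod (h (?M a b)) \<le> cmod (?M a b)"
    using Schwarz_Lemma(1)[OF holh h0 h1] Moebius_function_norm_lt_1[OF a b] by blast
  moreover have "h (?M a b) = ?M (\<phi> a) (\<phi> b)"
    using Moebius_function_compose[of "- a" a b] a b by (simp add: h_def)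
  ultimately have "cmod (\<phi> a - \<phi> b) / cmod (1 - cnj (\<phi> a) * \<phi> b) \<le> cmod (a - b) / cmod (1 - cnj a * b)"
    by (simp add: Moebius_function_simple norm_divide norm_minus_commute)
  then show ?thesis
    unfolding poincare_dist_def
    by (intro artanh_mono_real pseudohyperbolic_less_1 a b) (auto intro: less_le_trans[of _ 0])
qed

text \<open>Along a chain, each link raises \<open>artanh (cmod (x i))\<close> by at most its
  Poincare length, by Schwarz-Pick. Telescoping from \<open>x 0 = 0\<close> bounds every chain from
  below.\<close>

lemma kobayashi_disc_ge:
  assumes "cmod \<zeta> < 1"
  shows "artanh (cmod \<zeta>) \<le> kobayashi_disc 0 \<zeta>"
  unfolding kobayashi_disc_def kobayashi_dist_def
proof (rule cInf_greatest, goal_cases)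
  case 1
  \<comment> \<open>The infimum bound requires at least one chain: a single link through the
    identity map.\<close>
  show ?case
    unfolding ex_in_conv[symmetric] mem_Collect_eq
    by (rule exI[where x = "poincare_dist 0 \<zeta>"], rule exI[where x = "1 :: nat"],
        rule exI[where x = "\<lambda>j. if j = 0 then 0 else \<zeta>"], rule exI[where x = "\<lambda>_ z. z"],
        rule exI[where x = "\<lambda>_. 0"], rule exI[where x = "\<lambda>_. \<zeta>"])
      (use assms in auto)
next
  case (2 s)
  then obtain k :: nat and x \<phi> a b where s: "s = (\<Sum>j<k. poincare_dist (a j) (b j))"
    and x: "x 0 = 0" "x k = \<zeta>"
    and c: "\<forall>j<k. (\<phi> j holomorphic_on ball 0 1 \<and> \<phi> j ` ball 0 1 \<subseteq> ball 0 1) \<and>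
       a j \<in> ball 0 1 \<and> b j \<in> ball 0 1 \<and> \<phi> j (a j) = x j \<and> \<phi> j (b j) = x (Suc j)"
    unfolding mem_Collect_eq by (elim exE conjE) (rule that, assumption+)
  have "i \<le> k \<Longrightarrow> artanh (cmod (x i)) \<le> (\<Sum>j<i. poincare_dist (a j) (b j))" for i
  proof (induction i)
    case 0
    then show ?case using x by simp
  next
    case (Suc i)
    then have i: "i < k" by simp
    note ci = c[rule_format, OF i]
    have "cmod (x i) < 1" "cmod (x (Suc i)) < 1"
      using ci by (metis image_subset_iff mem_ball_0)+
    then have "artanh (cmod (x (Suc i))) - artanh (cmod (x i)) \<le> poincare_dist (x i) (x (Suc i))"
      by (rule artanh_cmod_diff_le_poincare_dist)
    also have "\<dots> \<le> poincare_dist (a i) (b i)"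
      using Schwarz_Pick[of "\<phi> i" "a i" "b i"] ci by auto
    finally show ?case
      using Suc i by simp
  qed
  from this[of k] show ?case
    using s x by simp
qed

section \<open>Upper bounds for the Kobayashi distance of a convex domain by chains of affine
  discs\<close>

lemma kobayashi_dist_le:
  assumes "x 0 = p" "x k = q"
    and "\<And>j. j < k \<Longrightarrow> \<phi> j \<in> H \<and> cmod (a j) < 1 \<and> cmod (b j) < 1 \<and>
       \<phi> j (a j) = x j \<and> \<phi> j (b j) = x (Suc j)"
  shows "kobayashi_dist H p q \<le> (\<Sum>j<k. poincare_dist (a j) (b j))"
  unfolding kobayashi_dist_def
proof (rule cInf_lower, goal_cases)
  case 1
  show ?case
    unfolding mem_Collect_eq using assms
    by (intro exI[where x = k] exI[where x = x] exI[where x = \<phi>] exI[where x = a] exI[where x = b]) simp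
next
  case 2
  show ?case
    by (rule bdd_belowI[of _ 0]) (auto intro!: sum_nonneg poincare_dist_nonneg)
qed

lemma vec_holomorphic_on_affine: "(\<lambda>z. p + (c * z) *s v) vec_holomorphic_on S"
  unfolding vec_holomorphic_on_def by (auto intro!: holomorphic_intros)

lemma norm_vector_scalar_mult:
  fixes v :: "complex ^ 'n"
  shows "norm (c *s v) = cmod c * norm v"
  by (simp add: norm_vec_def norm_mult L2_set_right_distrib)

lemma of_real_vector_scalar_mult: "complex_of_real t *s v = t *\<^sub>R v"
  by (simp add: vec_eq_iff scaleR_conv_of_real[where x = "v $ i" for i])

text \<open>This disc is at \<open>p\<close> for parameter 0 and at \<open>q\<close> for parameter
  1/2, so joining \<open>p\<close> to \<open>q\<close> through it costs
  \<open>artanh (1 / 2)\<close>.\<close>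

lemma affine_disc_subset:
  fixes p q :: "complex ^ 'n"
  assumes "ball p d \<subseteq> \<Omega>" "2 * norm (q - p) \<le> d" "0 < d"
  shows "(\<lambda>z. p + (2 * z) *s (q - p)) ` ball 0 1 \<subseteq> \<Omega>"
proof (rule image_subsetI)
  fix z :: complex assume z: "z \<in> ball 0 1"
  have "norm ((2 * z) *s (q - p)) = cmod z * (2 * norm (q - p))"
    unfolding norm_vector_scalar_mult by (simp add: norm_mult)
  also have "\<dots> \<le> cmod z * d"
    using assms by (intro mult_left_mono) auto
  also have "\<dots> < d"
    using z assms(3) by simp
  finally have "norm ((2 * z) *s (q - p)) < d" .
  moreover have "p + v \<in> \<Omega>" if "norm v < d" for v
    using that assms(1) by (auto simp: dist_norm)
  ultimately show "p + (2 * z) *s (q - p) \<in> \<Omega>"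
    by blast
qed

text \<open>The chain follows the segment from \<open>p\<close> to \<open>z\<close>, the remaining
  distance shrinking by the factor \<open>q\<close> at each step. By convexity the homothety with
  centre \<open>z\<close> and ratio \<open>q ^ j\<close> keeps the ball around \<open>p\<close>
  inside the domain, so there is always room for a disc of the same cost. After \<open>J\<close>
  steps the ball around \<open>z\<close> takes over with one last disc.\<close>

lemma kobayashi_vec_convex_le:
  fixes \<Omega> :: "(complex ^ 'n) set"
  assumes "convex \<Omega>" and z: "z \<in> \<Omega>"
    and d: "0 < d" "ball p d \<subseteq> \<Omega>" and e: "0 < e" "ball z e \<subseteq> \<Omega>"
    and q: "0 < q" "q < 1" "2 * (1 - q) * norm (p - z) \<le> d" and J: "2 * q ^ J * norm (p - z) \<le> e"
  shows "kobayashi_vec \<Omega> p z \<le> real (Suc J) * artanh (1 / 2)"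
proof -
  define y where "y j = z + q ^ j *\<^sub>R (p - z)" for j
  define x where "x j = (if j \<le> J then y j else z)" for j
  define \<phi> where "\<phi> j = (if j < J then (\<lambda>\<xi>. y j + (2 * \<xi>) *s (y (Suc j) - y j))
                              else (\<lambda>\<xi>. z + (2 * \<xi>) *s (y J - z)))" for j
  \<comment> \<open>The last disc is centred at its end point \<open>z\<close> and is therefore
    traversed backwards, from parameter 1/2 to 0.\<close>
  define a b :: "nat \<Rightarrow> complex" where "a j = (if j < J then 0 else 1/2)" and "b j = (if j < J then 1/2 else 0)" for j
  have ball_y: "ball (y j) (q ^ j * d) \<subseteq> \<Omega>" for j
  proof
    fix u assume u: "u \<in> ball (y j) (q ^ j * d)"
    define v where "v = (1 / q ^ j) *\<^sub>R (u - y j)"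
    have qj: "0 < q ^ j" "q ^ j \<le> 1" using q by (auto simp: power_le_one)
    have "norm v < d"
      using u qj by (simp add: v_def dist_norm norm_minus_commute divide_simps mult.commute)
    then have "p + v \<in> \<Omega>" using d by (auto simp: dist_norm)
    moreover have "u = (1 - q ^ j) *\<^sub>R z + q ^ j *\<^sub>R (p + v)"
      using q qj by (simp add: v_def y_def algebra_simps)
    ultimately show "u \<in> \<Omega>"
      using convexD[OF assms(1) z, of "p + v" "1 - q ^ j" "q ^ j"] qj by simp
  qed
  have step: "2 * norm (y (Suc j) - y j) \<le> q ^ j * d" for j
  proof -
    have "y (Suc j) - y j = - ((q ^ j * (1 - q)) *\<^sub>R (p - z))"
      by (simp add: y_def algebra_simps)
    then have "2 * norm (y (Suc j) - y j) = q ^ j * (2 * (1 - q) * norm (p - z))"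
      using q by (simp add: abs_mult)
    also have "\<dots> \<le> q ^ j * d"
      using q by (intro mult_left_mono) auto
    finally show ?thesis .
  qed
  have "kobayashi_vec \<Omega> p z \<le> (\<Sum>j<Suc J. poincare_dist (a j) (b j))"
    unfolding kobayashi_vec_def
  proof (rule kobayashi_dist_le[of x _ _ _ \<phi>])
    show "x 0 = p" "x (Suc J) = z" by (simp_all add: x_def y_def)
    fix j assume j: "j < Suc J"
    have "\<phi> j ` ball 0 1 \<subseteq> \<Omega>"
    proof (cases "j < J")
      case True
      then show ?thesis
        unfolding \<phi>_def using affine_disc_subset[OF ball_y step, of j] d q by simp
    next
      case False
      have "2 * norm (y J - z) \<le> e"
        using J q by (simp add: y_def mult.assoc)
      then show ?thesis
        unfolding \<phi>_def using False affine_disc_subset[OF e(2), of "y J"] e by simp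
    qed
    moreover have "\<phi> j vec_holomorphic_on ball 0 1"
      unfolding \<phi>_def by (cases "j < J") (simp_all only: if_True if_False vec_holomorphic_on_affine)
    moreover have "\<phi> j (a j) = x j" "\<phi> j (b j) = x (Suc j)"
      using j by (auto simp: \<phi>_def a_def b_def x_def less_Suc_eq)
    ultimately show "\<phi> j \<in> {\<phi>. \<phi> vec_holomorphic_on ball 0 1 \<and> \<phi> ` ball 0 1 \<subseteq> \<Omega>} \<and>
       cmod (a j) < 1 \<and> cmod (b j) < 1 \<and> \<phi> j (a j) = x j \<and> \<phi> j (b j) = x (Suc j)"
      by (simp add: a_def b_def)
  qed
  also have "\<dots> = (\<Sum>j<Suc J. artanh (1 / 2))"
    by (intro sum.cong) (auto simp: poincare_dist_def a_def b_def)
  finally show ?thesis by simp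
qed

section \<open>Nearest boundary points and the decay of the boundary distance along a
  geodesic\<close>

lemma frontier_point_at_infdist:
  fixes \<Omega> :: "('a::euclidean_space) set"
  assumes "open \<Omega>" "\<Omega> \<noteq> UNIV" "z \<in> \<Omega>"
  obtains w where "w \<in> frontier \<Omega>" "dist z w = infdist z (- \<Omega>)"
proof -
  have ne: "- \<Omega> \<noteq> {}" "closed (- \<Omega>)"
    using assms by (auto simp: closed_def)
  obtain w where w: "w \<in> - \<Omega>" "infdist z (- \<Omega>) = dist z w"
    using infdist_attains_inf[OF ne(2,1)] by blast
  have "w \<in> closure \<Omega>"
  proof -
    have "ball z (dist z w) \<subseteq> \<Omega>"
      using infdist_le[of _ "- \<Omega>" z] w(2) by force
    moreover have "0 < dist z w" using w(1) assms(3) by auto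
    ultimately have "cball z (dist z w) \<subseteq> closure \<Omega>"
      by (metis closure_ball closure_mono)
    then show ?thesis by auto
  qed
  with w assms(1) that show thesis
    by (auto simp: frontier_def interior_open)
qed

text \<open>If the boundary distance exceeded \<open>B * q ^ k\<close>, a chain of \<open>k\<close>
  discs would join \<open>f 0\<close> to \<open>f \<zeta>\<close> at cost
  \<open>k * ln 3 / 2\<close>. The isometry property forces a cost of at least
  \<open>k * ln 4 / 2\<close>. The radii \<open>1 - (1/4) ^ k\<close> are thus chosen so that 4
  beats the 3 coming from \<open>artanh (1 / 2)\<close>.\<close>

lemma infdist_geodesic_decay:
  fixes \<Omega> :: "(complex ^ 'n) set"
  assumes "open \<Omega>" "bounded \<Omega>" "convex \<Omega>" and f: "complex_geodesic \<Omega> f"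
  obtains q B where "0 < q" "q < 1" "0 < B"
    "\<And>k \<zeta>. k \<ge> 1 \<Longrightarrow> cmod \<zeta> = 1 - (1/4) ^ k \<Longrightarrow> infdist (f \<zeta>) (- \<Omega>) \<le> B * q ^ k"
proof -
  define p where "p = f 0"
  have fin: "f \<zeta> \<in> \<Omega>" if "cmod \<zeta> < 1" for \<zeta>
    using f that by (auto simp: complex_geodesic_def image_subset_iff)
  have p: "p \<in> \<Omega>" by (simp add: p_def fin)
  obtain d where d: "0 < d" "ball p d \<subseteq> \<Omega>"
    using assms(1) p open_contains_ball by blast
  obtain D where D: "0 < D" "\<And>x. x \<in> \<Omega> \<Longrightarrow> norm (p - x) \<le> D"
  proof -
    obtain M where M: "\<And>x. x \<in> \<Omega> \<Longrightarrow> dist p x \<le> M"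
      using assms(2) bounded_any_center[of \<Omega> p] by auto
    show thesis
      by (rule that[of "max M 1"]) (use M in \<open>force simp: dist_norm\<close>)+
  qed
  \<comment> \<open>Any ratio in (0,1) with \<open>2 * (1 - q) * D \<le> d\<close> works; the extra
    \<open>d\<close> in the denominator keeps \<open>q\<close> positive.\<close>
  define q where "q = 1 - d / (2 * D + d)"
  have q: "0 < q" "q < 1" using d D by (auto simp: q_def field_simps)
  have qd: "2 * (1 - q) * D \<le> d"
    using d D by (simp add: q_def field_simps)
  \<comment> \<open>A chain of \<open>k\<close> discs makes only \<open>k - 1\<close> shrinking
    steps, hence the division by \<open>q\<close>.\<close>
  define B where "B = 2 * D / q"
  have "infdist (f \<zeta>) (- \<Omega>) \<le> B * q ^ k" if k: "k \<ge> 1" "cmod \<zeta> = 1 - (1/4) ^ k" for k \<zeta>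
  proof (rule ccontr)
    define e where "e = infdist (f \<zeta>) (- \<Omega>)"
    obtain J where J: "k = Suc J" using k(1) by (cases k) auto
    assume "\<not> infdist (f \<zeta>) (- \<Omega>) \<le> B * q ^ k"
    then have e: "2 * q ^ J * D \<le> e" using q by (simp add: e_def B_def J mult_ac)
    have e0: "0 < e" using e q D(1) by (smt (verit) mult_pos_pos zero_less_power)
    have \<zeta>: "cmod \<zeta> < 1" using k by simp
    have n: "norm (p - f \<zeta>) \<le> D" using D fin[OF \<zeta>] by blast
    have "ball (f \<zeta>) e \<subseteq> \<Omega>"
      using infdist_le[of _ "- \<Omega>" "f \<zeta>"] unfolding e_def by force
    moreover have "2 * (1 - q) * norm (p - f \<zeta>) \<le> d"
      using qd n q by (smt (verit) mult_left_mono)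
    moreover have "2 * q ^ J * norm (p - f \<zeta>) \<le> e"
      using e n q by (smt (verit) mult_left_mono zero_less_power)
    ultimately have "kobayashi_vec \<Omega> p (f \<zeta>) \<le> real k * artanh (1 / 2)"
      unfolding J using kobayashi_vec_convex_le assms(3) fin[OF \<zeta>] d e0 q by blast
    moreover have "artanh (cmod \<zeta>) \<le> kobayashi_vec \<Omega> p (f \<zeta>)"
      using f \<zeta> kobayashi_disc_ge[OF \<zeta>] by (simp add: complex_geodesic_def p_def)
    ultimately have "artanh (cmod \<zeta>) \<le> real k * artanh (1 / 2)" by simp
    moreover have "artanh (1 / 2 :: real) = ln 3 / 2"
      by (simp add: artanh_def)
    moreover have "real k * (ln 4 / 2) \<le> artanh (cmod \<zeta>)"
    proof -
      \<comment> \<open>The right-hand side equals \<open>2 * 4 ^ k - 1\<close>.\<close>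
      have "(4::real) ^ k \<le> (1 + cmod \<zeta>) / (1 - cmod \<zeta>)"
        unfolding k(2) by (simp add: power_divide field_simps)
      then have "ln ((4::real) ^ k) \<le> ln ((1 + cmod \<zeta>) / (1 - cmod \<zeta>))"
        by (intro ln_mono) auto
      then show ?thesis by (simp add: artanh_def ln_realpow)
    qed
    ultimately have "real k * ln 4 \<le> real k * ln (3::real)" by simp
    then show False using k(1) by simp
  qed
  then show thesis
    using that[of q B] q D(1) by (simp add: B_def)
qed

section \<open>Coordinates, unitary frames, and a Schwarz estimate for maps into a
  half-plane\<close>

lemma last_coord_scaleR [simp]: "last_coord (t *\<^sub>R y) = t *\<^sub>R last_coord y"
  by (simp add: last_coord_def)

lemma init_coords_scaleR [simp]: "init_coords (t *\<^sub>R y) = t *\<^sub>R init_coords y"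
  by (simp add: init_coords_def vec_eq_iff)

lemma norm_last_coord_le: "cmod (last_coord y) \<le> norm y"
  unfolding last_coord_def norm_vec_def by (rule member_le_L2_set) auto

lemma norm_squared_split:
  "(norm y)\<^sup>2 = (norm (init_coords y))\<^sup>2 + (cmod (last_coord y))\<^sup>2"
proof -
  have sq: "(norm v)\<^sup>2 = (\<Sum>i\<in>UNIV. (cmod (v $ i))\<^sup>2)" for v :: "complex ^ 'n"
    by (simp add: norm_vec_def L2_set_def sum_nonneg)
  have "(\<Sum>i\<in>UNIV. (cmod (y $ i))\<^sup>2) = (cmod (y $ None))\<^sup>2 + (\<Sum>i\<in>range Some. (cmod (y $ i))\<^sup>2)"
    unfolding UNIV_option_conv by (rule sum.insert) auto
  also have "(\<Sum>i\<in>range Some. (cmod (y $ i))\<^sup>2) = (\<Sum>i\<in>UNIV. (cmod (y $ Some i))\<^sup>2)"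
    by (rule sum.reindex_cong[of Some]) auto
  finally show ?thesis
    unfolding sq by (simp add: init_coords_def last_coord_def)
qed

lemma norm_init_coords_le: "norm (init_coords y) \<le> norm y"
  by (rule power2_le_imp_le) (simp_all add: norm_squared_split[of y])

lemma norm_le_init_last: "norm y \<le> norm (init_coords y) + cmod (last_coord y)"
  by (rule power2_le_imp_le) (simp_all add: norm_squared_split[of y] power2_sum)

lemma unitary_norm:
  assumes "unitary_transformation U"
  shows "norm (U x) = norm x"
proof -
  have *: "hermitian_inner v v = complex_of_real ((norm v)\<^sup>2)" for v :: "complex ^ 'n"
    by (simp add: hermitian_inner_def norm_vec_def L2_set_def sum_nonneg complex_norm_square[symmetric])
  have "complex_of_real ((norm (U x))\<^sup>2) = complex_of_real ((norm x)\<^sup>2)"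
    using assms by (simp only: unitary_transformation_def flip: *)
  then have "(norm (U x))\<^sup>2 = (norm x)\<^sup>2"
    by (simp only: of_real_eq_iff)
  then show ?thesis by simp
qed

lemma unitary_scaleR:
  assumes "unitary_transformation U"
  shows "U (t *\<^sub>R x) = t *\<^sub>R U x"
proof -
  have "U (complex_of_real t *s x) = complex_of_real t *s U x"
    using assms by (intro vec.linear_scale) (simp add: unitary_transformation_def)
  then show ?thesis by (simp add: of_real_vector_scalar_mult)
qed

lemma holomorphic_on_unitary_component:
  fixes U :: "complex ^ 'n \<Rightarrow> complex ^ 'n"
  assumes U: "unitary_transformation U" and f: "f vec_holomorphic_on S"
  shows "(\<lambda>\<xi>. U (f \<xi> - w) $ i) holomorphic_on S"
proof -
  have "U v $ i = (\<Sum>j\<in>UNIV. matrix U $ i $ j * v $ j)" for v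
  proof -
    have "U v = matrix U *v v"
      using matrix_works[of U] U by (simp add: unitary_transformation_def)
    then show ?thesis by (simp only: matrix_vector_mult_def vec_lambda_beta)
  qed
  then show ?thesis
    using f by (auto simp: vec_holomorphic_on_def intro!: holomorphic_intros)
qed

text \<open>After rescaling the ball to the unit disc, a Cayley transform sending the value at the
  centre to 0 gives a self-map of the disc. The Schwarz lemma keeps it within radius 3/4, and
  undoing the transform bounds the original map.\<close>

lemma halfplane_Schwarz_bound:
  assumes hol: "\<phi> holomorphic_on ball c \<rho>" and Im: "\<And>\<xi>. \<xi> \<in> ball c \<rho> \<Longrightarrow> 0 \<le> Im (\<phi> \<xi>)"
    and \<rho>: "0 < \<rho>" and \<delta>: "0 < \<delta>" "cmod (\<phi> c) \<le> \<delta>" and \<xi>: "dist c \<xi> \<le> 3/4 * \<rho>"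
  shows "cmod (\<phi> \<xi>) \<le> 13 * \<delta>"
proof -
  \<comment> \<open>adding \<open>\<i>\<delta>\<close> makes the imaginary part positive, so that the Cayley transform applies\<close>
  define \<psi> where "\<psi> z = \<phi> (c + \<rho> * z) + \<i> * \<delta>" for z :: complex
  define p where "p = \<psi> 0"
  have mem: "c + \<rho> * z \<in> ball c \<rho>" if "cmod z < 1" for z :: complex
    using that \<rho> by (simp add: dist_norm norm_mult)
  have \<psi>Im: "0 < Im (\<psi> z)" if "cmod z < 1" for z
    using Im[OF mem[OF that]] \<delta> by (simp add: \<psi>_def)
  have pIm: "0 < Im p" using \<psi>Im[of 0] by (simp add: p_def)
  have "cmod p \<le> \<delta> + \<delta>"
    unfolding p_def \<psi>_def using \<delta> by (intro norm_triangle_le add_mono) (auto simp: norm_mult)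
  then have pIm2: "Im p \<le> 2 * \<delta>" using abs_Im_le_cmod[of p] by linarith
  have less: "cmod (v - p) < cmod (v - cnj p)" if "0 < Im v" for v
  proof -
    have "(cmod (v - cnj p))\<^sup>2 - (cmod (v - p))\<^sup>2 = 4 * Im v * Im p"
      unfolding cmod_power2 by (simp add: power2_eq_square algebra_simps)
    moreover have "0 < 4 * Im v * Im p" using that pIm by simp
    ultimately have "(cmod (v - p))\<^sup>2 < (cmod (v - cnj p))\<^sup>2" by linarith
    then show ?thesis by (rule power2_less_imp_less) simp
  qed
  define h where "h z = (\<psi> z - p) / (\<psi> z - cnj p)" for z
  have ne: "\<psi> z - cnj p \<noteq> 0" if "cmod z < 1" for z
    using less[OF \<psi>Im[OF that]] by (metis norm_ge_zero norm_zero not_le)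
  have "(\<phi> \<circ> (\<lambda>z. c + \<rho> * z)) holomorphic_on ball 0 1"
    using mem by (intro holomorphic_on_compose_gen[OF _ hol] holomorphic_intros) auto
  then have "\<psi> holomorphic_on ball 0 1"
    unfolding \<psi>_def o_def by (intro holomorphic_intros)
  then have holh: "h holomorphic_on ball 0 1"
    unfolding h_def using ne by (intro holomorphic_intros) auto
  have h1: "cmod (h z) < 1" if "cmod z < 1" for z
    using less[OF \<psi>Im[OF that]] ne[OF that] by (simp add: h_def norm_divide)
  define z where "z = (\<xi> - c) / \<rho>"
  have z: "cmod z \<le> 3/4" "\<psi> z = \<phi> \<xi> + \<i> * \<delta>"
    using \<xi> \<rho> by (simp_all add: z_def norm_divide dist_norm norm_minus_commute field_simps \<psi>_def)
  have "cmod (h z) \<le> 3/4"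
    using Schwarz_Lemma(1)[OF holh _ h1, of z] z(1) by (simp add: h_def p_def)
  then have "cmod (\<psi> z - p) \<le> 3/4 * cmod (\<psi> z - cnj p)"
    using ne[of z] z(1) by (simp add: h_def norm_divide divide_simps)
  also have "cmod (\<psi> z - cnj p) \<le> cmod (\<psi> z - p) + 2 * Im p"
  proof -
    have "\<psi> z - cnj p = (\<psi> z - p) + complex_of_real (2 * Im p) * \<i>"
      by (simp add: complex_eq_iff)
    moreover have "cmod (complex_of_real (2 * Im p) * \<i>) = 2 * Im p"
      using pIm by (simp add: norm_mult)
    ultimately show ?thesis
      by (metis norm_triangle_ineq)
  qed
  \<comment> \<open>Absorbing the first summand on the left gives \<open>6 * Im p\<close>, which is
    at most \<open>12 * \<delta>\<close>; the value at the centre adds the thirteenth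
    \<open>\<delta>\<close>.\<close>
  finally have "cmod (\<psi> z - p) \<le> 12 * \<delta>" using pIm2 by simp
  moreover have "\<phi> \<xi> = (\<psi> z - p) + \<phi> c"
    using z by (simp add: p_def \<psi>_def)
  ultimately show ?thesis
    using norm_triangle_ineq[of "\<psi> z - p" "\<phi> c"] \<delta> by simp
qed

section \<open>From the local support condition to global estimates, by convexity\<close>

definition supports_at ::
    "real \<Rightarrow> real \<Rightarrow> (complex ^ 'm \<Rightarrow> real) \<Rightarrow> (complex ^ ('m::finite) option) set \<Rightarrow> complex ^ 'm option \<Rightarrow>
      (complex ^ 'm option \<Rightarrow> complex ^ 'm option) \<Rightarrow> bool" where
  "supports_at R s F \<Omega> w U \<longleftrightarrow> unitary_transformation U \<and>
     (\<lambda>v. U (v - w)) ` closure \<Omega> \<inter> support_nbhd R s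
       \<subseteq> {z \<in> support_nbhd R s. Im (last_coord z) \<ge> F (init_coords z)}"

text \<open>Moving \<open>x\<close> towards \<open>w\<close> by the factor \<open>t\<close>
  multiplies \<open>U (x - w)\<close> by \<open>t\<close> and stays in the closure by convexity. For
  small \<open>t\<close> the moved point enters the box, so the local condition says something about
  every \<open>x\<close>.\<close>

lemma supports_at_scaled:
  assumes sup: "supports_at R s F \<Omega> w U" and "convex \<Omega>" "w \<in> closure \<Omega>" "x \<in> closure \<Omega>"
    and t: "0 \<le> t" "t \<le> 1" and y: "y = U (x - w)"
    and R: "t * norm (init_coords y) < R" and s: "t * cmod (last_coord y) < s"
  shows "F (t *\<^sub>R init_coords y) \<le> t * Im (last_coord y)"
proof -
  have "(1 - t) *\<^sub>R w + t *\<^sub>R x \<in> closure \<Omega>"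
    using convexD[OF convex_closure[OF assms(2)] assms(3,4), of "1 - t" t] t by simp
  moreover have "t *\<^sub>R y = U (((1 - t) *\<^sub>R w + t *\<^sub>R x) - w)"
    using sup by (simp add: supports_at_def y algebra_simps flip: unitary_scaleR)
  ultimately have "t *\<^sub>R y \<in> (\<lambda>v. U (v - w)) ` closure \<Omega>" by blast
  moreover have "\<bar>t * Re (last_coord y)\<bar> < s" "\<bar>t * Im (last_coord y)\<bar> < s"
    using s t mult_left_mono[OF abs_Re_le_cmod[of "last_coord y"] t(1)]
      mult_left_mono[OF abs_Im_le_cmod[of "last_coord y"] t(1)] by (simp_all add: abs_mult)
  then have "t *\<^sub>R y \<in> support_nbhd R s"
    using R t by (auto simp: support_nbhd_def)
  ultimately have "F (init_coords (t *\<^sub>R y)) \<le> Im (last_coord (t *\<^sub>R y))"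
    using sup unfolding supports_at_def by blast
  then show ?thesis by simp
qed

lemma supports_at_halfspace:
  assumes sup: "supports_at R s F \<Omega> w U" and "convex \<Omega>" "w \<in> closure \<Omega>" "x \<in> closure \<Omega>"
    and pos: "0 < R" "0 < s" "\<And>v. 0 \<le> F v"
  shows "0 \<le> Im (last_coord (U (x - w)))"
proof -
  define y where "y = U (x - w)"
  \<comment> \<open>Adding \<open>min R s\<close> ensures \<open>t \<le> 1\<close> and makes
    \<open>t * norm y\<close> strictly smaller than \<open>min R s\<close>.\<close>
  define M where "M = norm y + min R s"
  define t where "t = min R s / M"
  have M: "0 < M" "min R s \<le> M"
    using pos by (auto simp: M_def intro: add_nonneg_pos)
  have t: "0 < t" "t \<le> 1" using M pos by (simp_all add: t_def)
  have "t * norm y < t * M"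
    using t pos by (simp add: M_def)
  then have "t * norm y < min R s"
    using M by (simp add: t_def)
  then have ty: "t * norm (init_coords y) < R" "t * cmod (last_coord y) < s"
    using mult_left_mono[OF norm_init_coords_le[of y] less_imp_le[OF t(1)]]
      mult_left_mono[OF norm_last_coord_le[of y] less_imp_le[OF t(1)]] by linarith+
  have "0 \<le> t * Im (last_coord y)"
    using order_trans[OF pos(3) supports_at_scaled[OF assms(1-4) less_imp_le[OF t(1)] t(2) y_def ty]] .
  then show ?thesis
    using t by (simp add: y_def zero_le_mult_iff)
qed

text \<open>If the tangential part had norm at least \<open>R\<close>, scaling it to the sphere of
  radius \<open>R / 2\<close> would give a value of \<open>F\<close> that is both above and at most
  \<open>\<sigma>\<close>. So the point already lies in the box and the support condition applies
  unscaled.\<close>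

lemma supports_at_bound:
  assumes sup: "supports_at R s F \<Omega> w U" and cv: "convex \<Omega>" "w \<in> closure \<Omega>" "x \<in> closure \<Omega>"
    and pos: "0 < R" and \<sigma>: "\<sigma> < s" "\<And>v. norm v = R / 2 \<Longrightarrow> \<sigma> < F v"
    and y: "y = U (x - w)" "cmod (last_coord y) \<le> \<sigma>"
  shows "F (init_coords y) \<le> \<sigma>"
proof (cases "norm (init_coords y) < R")
  case True
  then show ?thesis
    using supports_at_scaled[OF sup cv _ _ y(1), of 1] y(2) \<sigma> abs_Im_le_cmod[of "last_coord y"]
    by simp
next
  case False
  let ?n = "norm (init_coords y)"
  define t where "t = R / (2 * ?n)"
  have t: "0 \<le> t" "t \<le> 1" using False pos by (auto simp: t_def divide_le_eq)
  have tn: "norm (t *\<^sub>R init_coords y) = R / 2"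
    using False pos by (auto simp: t_def)
  have "t * cmod (last_coord y) \<le> \<sigma>"
    using mult_mono[OF t(2) y(2)] by simp
  moreover have "F (t *\<^sub>R init_coords y) \<le> t * Im (last_coord y)"
    using supports_at_scaled[OF sup cv t y(1)] calculation \<sigma>(1) tn t pos by simp
  moreover have "t * Im (last_coord y) \<le> t * cmod (last_coord y)"
    using t abs_Im_le_cmod[of "last_coord y"] by (intro mult_left_mono) auto
  ultimately show ?thesis
    using \<sigma>(2)[OF tn] by linarith
qed

section \<open>Maximum principle, continuous extension from summable increments, and the oscillation
  bound\<close>

lemma holomorphic_vec_max_modulus:
  fixes F :: "complex \<Rightarrow> complex ^ 'n"
  assumes hol: "F vec_holomorphic_on cball 0 1" and B: "\<And>u. cmod u = 1 \<Longrightarrow> norm (F u) \<le> B"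
    and u: "cmod u \<le> 1"
  shows "norm (F u) \<le> real CARD('n) * B"
proof -
  have "cmod (F u $ i) \<le> B" for i
  proof (rule maximum_modulus_frontier[where S = "cball 0 1" and f = "\<lambda>u. F u $ i"])
    show "(\<lambda>u. F u $ i) holomorphic_on interior (cball 0 1)"
      using hol by (auto simp: vec_holomorphic_on_def intro: holomorphic_on_subset[OF _ ball_subset_cball])
    show "continuous_on (closure (cball 0 1)) (\<lambda>u. F u $ i)"
      using hol by (auto simp: vec_holomorphic_on_def intro: holomorphic_on_imp_continuous_on)
    show "cmod (F z $ i) \<le> B" if "z \<in> frontier (cball 0 1)" for z
    proof -
      have "cmod (F z $ i) \<le> norm (F z)"
        unfolding norm_vec_def by (rule member_le_L2_set) auto
      then show ?thesis using B[of z] that by simp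
    qed
  qed (use u in auto)
  \<comment> \<open>The maximum principle was applied coordinatewise; passing back to the norm
    through the sum of the coordinates costs the factor \<open>CARD('n)\<close>.\<close>
  then have "(\<Sum>i\<in>UNIV. cmod (F u $ i)) \<le> (\<Sum>i\<in>(UNIV :: 'n set). B)"
    by (intro sum_mono)
  then show ?thesis
    using L2_set_le_sum[of UNIV "\<lambda>i. cmod (F u $ i)"] by (simp add: norm_vec_def)
qed

text \<open>The dilates of \<open>f\<close> are continuous on the closed disc, and the maximum
  principle carries the bounds on their differences from the circle inwards. The telescoping series
  then passes the Weierstrass M-test, and its sum agrees with \<open>f\<close> inside because
  \<open>f\<close> is continuous there.\<close>

lemma continuous_extension_if_summable_increments:
  fixes f :: "complex \<Rightarrow> complex ^ 'n" and r :: "nat \<Rightarrow> real"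
  assumes hol: "f vec_holomorphic_on ball 0 1"
    and r: "\<And>k. 0 \<le> r k" "\<And>k. r k < 1" "r \<longlonglongrightarrow> 1"
    and inc: "\<forall>\<^sub>F k in sequentially. \<forall>u::complex. cmod u = 1 \<longrightarrow> norm (f (r (Suc k) * u) - f (r k * u)) \<le> \<eta> k"
    and \<eta>: "summable \<eta>"
  shows "\<exists>g. continuous_on (cball 0 1) g \<and> (\<forall>\<zeta>\<in>ball 0 1. g \<zeta> = f \<zeta>)"
proof -
  define F where "F k u = f (complex_of_real (r k) * u)" for k u
  have mem: "complex_of_real (r k) * u \<in> ball 0 1" if "cmod u \<le> 1" for k and u :: complex
  proof -
    have "r k * cmod u \<le> r k * 1" using that r(1)[of k] by (intro mult_left_mono)
    then show ?thesis using r(1,2)[of k] by (simp add: norm_mult)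
  qed
  have holF: "F k vec_holomorphic_on cball 0 1" for k
    unfolding vec_holomorphic_on_def
  proof
    fix i
    have "((\<lambda>\<zeta>. f \<zeta> $ i) \<circ> (\<lambda>u. r k * u)) holomorphic_on cball 0 1"
      using hol mem by (intro holomorphic_on_compose_gen[where t = "ball 0 1"])
        (auto simp: vec_holomorphic_on_def intro!: holomorphic_intros)
    then show "(\<lambda>u. F k u $ i) holomorphic_on cball 0 1"
      by (simp add: F_def o_def)
  qed
  have contF: "continuous_on (cball 0 1) (F k)" for k
  proof -
    have "continuous_on (cball 0 1) (\<lambda>u. \<chi> i. F k u $ i)"
      using holF[of k] unfolding vec_holomorphic_on_def
      by (intro continuous_on_vec_lambda) (auto intro: holomorphic_on_imp_continuous_on)
    then show ?thesis by simp
  qed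
  have "\<forall>\<^sub>F k in sequentially. \<forall>u\<in>cball 0 1. norm (F (Suc k) u - F k u) \<le> real CARD('n) * \<eta> k"
    using inc
  proof eventually_elim
    case (elim k)
    have "(\<lambda>u. F (Suc k) u - F k u) vec_holomorphic_on cball 0 1"
      using holF[of k] holF[of "Suc k"] by (auto simp: vec_holomorphic_on_def intro!: holomorphic_intros)
    then show ?case
      using elim by (intro ballI holomorphic_vec_max_modulus) (auto simp: F_def)
  qed
  then have "uniform_limit (cball 0 1) (\<lambda>n u. \<Sum>k<n. F (Suc k) u - F k u)
      (\<lambda>u. \<Sum>k. F (Suc k) u - F k u) sequentially"
    by (rule Weierstrass_m_test_ev) (rule summable_mult[OF \<eta>])
  then have lim: "uniform_limit (cball 0 1) (\<lambda>n u. F n u - F 0 u)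
      (\<lambda>u. \<Sum>k. F (Suc k) u - F k u) sequentially"
    by (simp only: sum_lessThan_telescope[of "\<lambda>k. F k u" for u])
  define g where "g u = F 0 u + (\<Sum>k. F (Suc k) u - F k u)" for u
  have "continuous_on (cball 0 1) (\<lambda>u. \<Sum>k. F (Suc k) u - F k u)"
    using contF by (intro uniform_limit_theorem[OF _ lim] always_eventually allI continuous_intros) auto
  then have "continuous_on (cball 0 1) g"
    unfolding g_def by (intro continuous_intros contF)
  moreover have "g \<zeta> = f \<zeta>" if \<zeta>: "\<zeta> \<in> ball 0 1" for \<zeta>
  proof -
    have "(\<lambda>n. F n \<zeta> - F 0 \<zeta>) \<longlonglongrightarrow> (\<Sum>k. F (Suc k) \<zeta> - F k \<zeta>)"
      using tendsto_uniform_limitI[OF lim] \<zeta> by auto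
    then have "(\<lambda>n. F n \<zeta>) \<longlonglongrightarrow> g \<zeta>"
      using tendsto_add[OF tendsto_const[of "F 0 \<zeta>"]] by (fastforce simp: g_def)
    moreover have "(\<lambda>n. F n \<zeta>) \<longlonglongrightarrow> f \<zeta>"
    proof -
      have "continuous_on (ball 0 1) (\<lambda>u. \<chi> i. f u $ i)"
        using hol unfolding vec_holomorphic_on_def
        by (intro continuous_on_vec_lambda) (auto intro: holomorphic_on_imp_continuous_on)
      then have "isCont f \<zeta>"
        using \<zeta> by (simp add: continuous_on_eq_continuous_at)
      moreover have "(\<lambda>n. r n * \<zeta>) \<longlonglongrightarrow> complex_of_real 1 * \<zeta>"
        by (intro tendsto_intros r)
      ultimately show ?thesis
        unfolding F_def by (auto intro: isCont_tendsto_compose)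
    qed
    ultimately show ?thesis using LIMSEQ_unique by blast
  qed
  ultimately show ?thesis by blast
qed

text \<open>In a frame at the boundary point \<open>w\<close> nearest to \<open>f \<zeta>\<close>,
  the normal coordinate maps into a half-plane and has size at most \<open>\<delta>\<close> at
  \<open>\<zeta>\<close>, hence at most \<open>13 * \<delta>\<close> at \<open>\<xi>\<close>. The
  support condition turns this into the bound \<open>\<epsilon>\<close> on the tangential part, and
  the distance from \<open>f \<zeta>\<close> to \<open>w\<close> adds the fourteenth
  \<open>\<delta>\<close>.\<close>

lemma oscillation_bound:
  fixes \<Omega> :: "(complex ^ ('m::finite) option) set"
  assumes \<Omega>: "open \<Omega>" "convex \<Omega>" "\<Omega> \<noteq> UNIV" and hol: "f vec_holomorphic_on ball 0 1"
    and img: "f ` ball 0 1 \<subseteq> \<Omega>"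
    and sup: "\<And>w. w \<in> frontier \<Omega> \<Longrightarrow> \<exists>U. supports_at R s F \<Omega> w U"
    and pos: "0 < R" "0 < s" "\<And>v. 0 \<le> F v"
    and \<zeta>: "cmod \<zeta> < 1" "infdist (f \<zeta>) (- \<Omega>) \<le> \<delta>" and \<delta>: "0 < \<delta>" "13 * \<delta> < s"
    and F: "\<And>v. norm v = R / 2 \<Longrightarrow> 13 * \<delta> < F v" "\<And>v. F v \<le> 13 * \<delta> \<Longrightarrow> norm v \<le> \<epsilon>"
    and \<xi>: "dist \<zeta> \<xi> \<le> 3/4 * (1 - cmod \<zeta>)"
  shows "norm (f \<xi> - f \<zeta>) \<le> \<epsilon> + 14 * \<delta>"
proof -
  have f\<zeta>: "f \<zeta> \<in> \<Omega>" using img \<zeta>(1) by auto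
  obtain w where w: "w \<in> frontier \<Omega>" "dist (f \<zeta>) w = infdist (f \<zeta>) (- \<Omega>)"
    using frontier_point_at_infdist[OF \<Omega>(1,3) f\<zeta>] .
  have wc: "w \<in> closure \<Omega>" using w by (simp add: frontier_def)
  obtain U where U: "supports_at R s F \<Omega> w U" using sup w by blast
  then have Un: "unitary_transformation U" by (simp add: supports_at_def)
  define \<rho> where "\<rho> = 1 - cmod \<zeta>"
  have \<rho>: "0 < \<rho>" "dist \<zeta> \<xi> \<le> 3/4 * \<rho>" using \<zeta> \<xi> by (simp_all add: \<rho>_def)
  have b: "ball \<zeta> \<rho> \<subseteq> ball 0 1"
    by (simp add: \<rho>_def ball_subset_ball_iff)
  have cl: "f x \<in> closure \<Omega>" if "x \<in> ball \<zeta> \<rho>" for x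
    using that b img closure_subset by blast
  define y where "y x = U (f x - w)" for x
  have dw: "norm (f \<zeta> - w) \<le> \<delta>" using w \<zeta> by (simp add: dist_norm)
  have "cmod (last_coord (y \<xi>)) \<le> 13 * \<delta>"
  proof (rule halfplane_Schwarz_bound[OF _ _ \<rho>(1) \<delta>(1) _ \<rho>(2)])
    have "f vec_holomorphic_on ball \<zeta> \<rho>"
      using hol b by (auto simp: vec_holomorphic_on_def intro: holomorphic_on_subset)
    from holomorphic_on_unitary_component[OF Un this]
    show "(\<lambda>x. last_coord (y x)) holomorphic_on ball \<zeta> \<rho>"
      unfolding last_coord_def y_def .
    show "0 \<le> Im (last_coord (y x))" if "x \<in> ball \<zeta> \<rho>" for x
      unfolding y_def using supports_at_halfspace[OF U \<Omega>(2) wc cl[OF that] pos] .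
    show "cmod (last_coord (y \<zeta>)) \<le> \<delta>"
      using norm_last_coord_le[of "y \<zeta>"] dw unfolding y_def unitary_norm[OF Un] by linarith
  qed
  moreover have "\<xi> \<in> ball \<zeta> \<rho>" using \<rho> by simp
  ultimately have "F (init_coords (y \<xi>)) \<le> 13 * \<delta>" "cmod (last_coord (y \<xi>)) \<le> 13 * \<delta>"
    using supports_at_bound[OF U \<Omega>(2) wc cl pos(1) \<delta>(2) F(1) y_def] by auto
  then have "norm (y \<xi>) \<le> \<epsilon> + 13 * \<delta>"
    using F(2) norm_le_init_last[of "y \<xi>"] by fastforce
  then have "norm (f \<xi> - w) \<le> \<epsilon> + 13 * \<delta>"
    by (simp add: y_def unitary_norm[OF Un])
  then show ?thesis
    using dw norm_triangle_ineq4[of "f \<xi> - w" "f \<zeta> - w"] by simp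
qed

section \<open>Inverting \<open>Psi\<close> and summing the oscillations over the circles\<close>

lemma Psi_nonneg: "0 \<le> Psi \<alpha> x"
  by (simp add: Psi_def)

text \<open>Inverts \<open>Psi\<close> at the level \<open>exp (- m)\<close>; with \<open>m\<close>
  proportional to \<open>k\<close> it produces the rate
  \<open>k powr (- 1 / \<alpha>)\<close>.\<close>

lemma Psi_le_exp_imp_le:
  assumes "Psi \<alpha> x \<le> exp (- m)" "0 < m" "0 < \<alpha>"
  shows "x \<le> m powr (- 1 / \<alpha>)"
proof (cases "0 < x")
  case True
  then have "m \<le> x powr - \<alpha>"
    using assms(1) by (simp add: Psi_def powr_minus_divide)
  then have "(x powr - \<alpha>) powr (- 1 / \<alpha>) \<le> m powr (- 1 / \<alpha>)"
    using assms by (intro powr_mono2') auto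
  then show ?thesis
    using True assms(3) by (simp add: powr_powr)
next
  case False
  have "0 \<le> m powr (- 1 / \<alpha>)" by simp
  then show ?thesis using False by linarith
qed

theorem theorem1p4:
  fixes \<Omega> :: "(complex ^ ('m::finite) option) set"
    and C \<alpha> r :: real
  assumes "open \<Omega>" and "\<Omega> \<noteq> {}" and "bounded \<Omega>" and "convex \<Omega>"
    and "C1_boundary \<Omega>"
    and "C > 0" and "0 < \<alpha>" and "\<alpha> < 1"
    and "supports_from_outside r (\<lambda>z'. C * Psi \<alpha> (norm z')) \<Omega>"
  shows "\<forall>f. complex_geodesic \<Omega> f \<longrightarrow>
           (\<exists>g. continuous_on (cball 0 1) g \<and> (\<forall>\<zeta>\<in>ball 0 1. g \<zeta> = f \<zeta>))"
proof (intro allI impI)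
  fix f assume geo: "complex_geodesic \<Omega> f"
  let ?F = "\<lambda>v :: complex ^ 'm. C * Psi \<alpha> (norm v)"
  have hol: "f vec_holomorphic_on ball 0 1" and img: "f ` ball 0 1 \<subseteq> \<Omega>"
    using geo by (auto simp: complex_geodesic_def)
  have ne: "\<Omega> \<noteq> UNIV" using assms(3) not_bounded_UNIV by metis
  obtain R s where Rs: "0 < R" "0 < s"
    and sup: "\<And>w. w \<in> frontier \<Omega> \<Longrightarrow> \<exists>U. supports_at R s ?F \<Omega> w U"
  proof -
    obtain R s where "0 < R" "0 < s" and "\<forall>w\<in>frontier \<Omega>. \<exists>U. unitary_transformation U \<and>
          U ` complex_tangent_space \<Omega> w = {v. last_coord v = 0} \<and>
          U (inward_unit_normal \<Omega> w) = axis None \<i> \<and>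
          (\<lambda>v. U (v - w)) ` closure \<Omega> \<inter> support_nbhd R s
            \<subseteq> {z \<in> support_nbhd R s. Im (last_coord z) \<ge> ?F (init_coords z)}"
      using assms(9) unfolding supports_from_outside_def by (elim conjE exE) (rule that)
    then show thesis
      by (intro that[of R s]) (auto simp: supports_at_def)
  qed
  obtain q B where q: "0 < q" "q < 1" "0 < B"
    and decay: "\<And>k \<zeta>. k \<ge> 1 \<Longrightarrow> cmod \<zeta> = 1 - (1/4) ^ k \<Longrightarrow> infdist (f \<zeta>) (- \<Omega>) \<le> B * q ^ k"
    using infdist_geodesic_decay[OF assms(1,3,4) geo] by metis
  \<comment> \<open>Splitting \<open>q ^ k\<close> as \<open>p ^ k * p ^ k\<close> lets one factor
    absorb the constants \<open>13\<close>, \<open>B\<close> and \<open>C\<close>, while the other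
    remains as \<open>exp (- m)\<close> with \<open>m\<close> exactly linear in
    \<open>k\<close>.\<close>
  define p where "p = sqrt q"
  have p: "0 < p" "p < 1" "q = p * p" using q by (auto simp: p_def)
  define \<epsilon> where "\<epsilon> k = (real k * - ln p) powr (- 1 / \<alpha>)" for k :: nat
  define \<eta> where "\<eta> k = \<epsilon> k + 14 * (B * q ^ k)" for k
  have q0: "(\<lambda>k. 13 * (B * q ^ k)) \<longlonglongrightarrow> 0" and p0: "(\<lambda>k. 13 * (B * p ^ k)) \<longlonglongrightarrow> 0"
    using q p by (auto intro!: tendsto_mult_right_zero LIMSEQ_power_zero)
  have F2: "0 < C * Psi \<alpha> (R / 2)" using assms(6) Rs by (simp add: Psi_def)
  have inc: "\<forall>\<^sub>F k in sequentially. \<forall>u::complex. cmod u = 1 \<longrightarrow>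
      norm (f (complex_of_real (1 - (1/4) ^ Suc k) * u) - f (complex_of_real (1 - (1/4) ^ k) * u)) \<le> \<eta> k"
    \<comment> \<open>For large \<open>k\<close>, the bound \<open>13 * (B * q ^ k)\<close> is below
      \<open>s\<close> and below the value of the supporting function on the sphere of radius
      \<open>R / 2\<close>, and \<open>13 * (B * p ^ k)\<close> is below \<open>C\<close>.\<close>
    using order_tendstoD(2)[OF q0 Rs(2)] order_tendstoD(2)[OF q0 F2] order_tendstoD(2)[OF p0 assms(6)]
      eventually_ge_at_top[of 1]
  proof eventually_elim
    case (elim k)
    show ?case
    proof (intro allI impI)
      fix u :: complex assume u: "cmod u = 1"
      define \<zeta> where "\<zeta> = complex_of_real (1 - (1/4) ^ k) * u"
      define \<xi> where "\<xi> = complex_of_real (1 - (1/4) ^ Suc k) * u"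
      have k1: "(1/4) ^ k \<le> (1::real)" by (simp add: power_le_one)
      have \<zeta>: "cmod \<zeta> = 1 - (1/4) ^ k"
        using k1 u unfolding \<zeta>_def norm_mult norm_of_real by simp
      \<comment> \<open>Consecutive radii differ by exactly 3/4 of the distance from
        \<open>\<zeta>\<close> to the unit circle, the reach of the oscillation bound.\<close>
      have "\<zeta> - \<xi> = - (complex_of_real (3/4 * (1/4) ^ k) * u)"
        by (simp add: \<zeta>_def \<xi>_def algebra_simps)
      then have \<xi>: "dist \<zeta> \<xi> \<le> 3/4 * (1 - cmod \<zeta>)"
        unfolding dist_norm \<zeta> by (simp only: norm_minus_cancel norm_mult norm_of_real u) simp
      have small: "norm v \<le> \<epsilon> k" if "?F v \<le> 13 * (B * q ^ k)" for v
      proof -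
        have "13 * (B * q ^ k) = (13 * (B * p ^ k)) * p ^ k"
          by (simp add: p power_mult_distrib)
        also have "\<dots> \<le> C * p ^ k"
          using elim p by (intro mult_right_mono) auto
        also have "p ^ k = exp (- (real k * - ln p))"
          using p by (simp add: exp_of_nat_mult)
        finally have "C * Psi \<alpha> (norm v) \<le> C * exp (- (real k * - ln p))"
          using that by linarith
        then have "Psi \<alpha> (norm v) \<le> exp (- (real k * - ln p))"
          using assms(6) by (simp only: mult_le_cancel_left_pos)
        moreover have "0 < real k * - ln p"
          using elim p by (intro mult_pos_pos) auto
        ultimately show ?thesis
          unfolding \<epsilon>_def using assms(7) by (rule Psi_le_exp_imp_le)
      qed
      have "norm (f \<xi> - f \<zeta>) \<le> \<epsilon> k + 14 * (B * q ^ k)"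
      proof (rule oscillation_bound[OF assms(1,4) ne hol img sup Rs _ _ _ _ _ _ small \<xi>])
        show "cmod \<zeta> < 1" by (simp add: \<zeta>)
        show "infdist (f \<zeta>) (- \<Omega>) \<le> B * q ^ k" using decay[OF _ \<zeta>] elim by simp
        show "0 < B * q ^ k" using q by simp
      qed (use elim assms(6) Psi_nonneg in auto)
      then show "norm (f (complex_of_real (1 - (1/4) ^ Suc k) * u)
          - f (complex_of_real (1 - (1/4) ^ k) * u)) \<le> \<eta> k"
        unfolding \<eta>_def \<zeta>_def \<xi>_def .
    qed
  qed
  have "summable \<eta>"
  proof -
    \<comment> \<open>Here \<open>\<alpha> < 1\<close> makes the exponent small enough for the
      p-series to converge.\<close>
    have "- 1 / \<alpha> < - 1" using assms(7,8) by simp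
    then have "summable (\<lambda>k. real k powr (- 1 / \<alpha>))"
      by (simp only: summable_real_powr_iff)
    then have "summable (\<lambda>k. real k powr (- 1 / \<alpha>) * (- ln p) powr (- 1 / \<alpha>))"
      by (rule summable_mult2)
    then have "summable \<epsilon>"
      unfolding \<epsilon>_def using p by (subst powr_mult) auto
    moreover have "summable (\<lambda>k. 14 * (B * q ^ k))"
      using q by (intro summable_mult summable_geometric) auto
    ultimately show ?thesis
      unfolding \<eta>_def by (rule summable_add)
  qed
  moreover have "(\<lambda>k. 1 - (1/4) ^ k) \<longlonglongrightarrow> (1 - 0 :: real)"
    by (intro tendsto_intros LIMSEQ_power_zero) simp
  ultimately show "\<exists>g. continuous_on (cball 0 1) g \<and> (\<forall>\<zeta>\<in>ball 0 1. g \<zeta> = f \<zeta>)"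
    using inc
    by (intro continuous_extension_if_summable_increments[OF hol, where r = "\<lambda>k. 1 - (1/4) ^ k"])
      (auto simp: power_le_one)
qed

end
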